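(* Let $A$ be a left brace whose additive group has no elements of order $2$. If $(-a)\cdot b=-(a\cdot b)$ for every $a,b\in A$, then $A$ is a two-sided brace, and hence $(A,+,\cdot)$ is a Jacobson radical ring. Furthermore, if $A$ is finite, then $A$ is a nilpotent ring.
   Context: A left brace is an abelian group $(A,+)$ with a multiplication $\cdot$ such that $a\cdot(b+c)=a\cdot b+a\cdot c$ for all $a,b,c\in A$ and such that the circle operation $a\circ b=a\cdot b+a+b$ makes $A$ into a group (with identity $0$). A left brace is two-sided if moreover $(a+b)\cdot c=a\cdot c+b\cdot c$ for all $a,b,c\in A$; equivalently $(a+b)\circ c+c=a\circ c+b\circ c$. A Jacobson radical ring is an associative ring (not necessarily unital) $(A,+,\cdot)$ for which $a\circ b=a\cdot b+a+b$ makes $A$ into a group. A ring is nilpotent if for some $n$ all products of $n$ elements vanish. *)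

theory Defs
  imports "HOL-Algebra.Algebra"
begin

text \<open>
  All structures below are carried by a \<open>ring\<close> record.  None of them is required to have a multiplicative
  identity, so the record field \<open>one\<close> is never mentioned and carries no assumption.
\<close>

definition circ :: "('a, 'b) ring_scheme \<Rightarrow> 'a \<Rightarrow> 'a \<Rightarrow> 'a" where
  "circ A a b = a \<otimes>\<^bsub>A\<^esub> b \<oplus>\<^bsub>A\<^esub> a \<oplus>\<^bsub>A\<^esub> b"

definition circle_group :: "('a, 'b) ring_scheme \<Rightarrow> 'a monoid" where
  "circle_group A = \<lparr>carrier = carrier A, monoid.mult = circ A, one = \<zero>\<^bsub>A\<^esub>\<rparr>"

locale left_brace = abelian_group A for A (structure) +
  assumes m_closed: "\<lbrakk>a \<in> carrier A; b \<in> carrier A\<rbrakk> \<Longrightarrow> a \<otimes> b \<in> carrier A"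
    and r_distr: "\<lbrakk>a \<in> carrier A; b \<in> carrier A; c \<in> carrier A\<rbrakk>
      \<Longrightarrow> a \<otimes> (b \<oplus> c) = a \<otimes> b \<oplus> a \<otimes> c"
    and circle_group: "group (circle_group A)"

locale two_sided_brace = left_brace +
  assumes l_distr: "\<lbrakk>a \<in> carrier A; b \<in> carrier A; c \<in> carrier A\<rbrakk>
      \<Longrightarrow> (a \<oplus> b) \<otimes> c = a \<otimes> c \<oplus> b \<otimes> c"

text \<open>The library's locale \<open>ring\<close> is unital, hence the following.\<close>

locale nonunital_ring = abelian_group A for A (structure) +
  assumes m_closed: "\<lbrakk>a \<in> carrier A; b \<in> carrier A\<rbrakk> \<Longrightarrow> a \<otimes> b \<in> carrier A"
    and m_assoc: "\<lbrakk>a \<in> carrier A; b \<in> carrier A; c \<in> carrier A\<rbrakk>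
      \<Longrightarrow> (a \<otimes> b) \<otimes> c = a \<otimes> (b \<otimes> c)"
    and l_distr: "\<lbrakk>a \<in> carrier A; b \<in> carrier A; c \<in> carrier A\<rbrakk>
      \<Longrightarrow> (a \<oplus> b) \<otimes> c = a \<otimes> c \<oplus> b \<otimes> c"
    and r_distr: "\<lbrakk>a \<in> carrier A; b \<in> carrier A; c \<in> carrier A\<rbrakk>
      \<Longrightarrow> a \<otimes> (b \<oplus> c) = a \<otimes> b \<oplus> a \<otimes> c"

locale jacobson_radical_ring = nonunital_ring +
  assumes circle_group: "group (circle_group A)"

text \<open>
  Without an identity there is no empty product, so the number \<open>n\<close> of factors must be positive;
  a product of \<open>n\<close> factors is given by its first factor and the list of the remaining ones.
\<close>

locale nilpotent_ring = nonunital_ring +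
  assumes nilpotent: "\<exists>n>0. \<forall>a as. a \<in> carrier A \<and> set as \<subseteq> carrier A \<and> length (a # as) = n
      \<longrightarrow> foldl (\<otimes>) a as = \<zero>"

end

theory Submission
  imports Defs
begin

text \<open>
  Write \<open>L\<^sub>a\<close> for left multiplication by \<open>a\<close>.  The circle operation satisfies
  \<open>L\<^bsub>a \<circ> b\<^esub> = L\<^sub>a L\<^sub>b + L\<^sub>a + L\<^sub>b\<close>, and \<open>a \<circ> b + a \<circ> (- b) = a + a\<close>.  Since \<open>a \<circ> b\<close> takes any prescribed value
  \<open>a + t\<close>, the hypothesis \<open>L\<^bsub>-b\<^esub> = - L\<^sub>b\<close> yields Jensen's equation \<open>L\<^bsub>a+t\<^esub> + L\<^bsub>a-t\<^esub> = 2 L\<^sub>a\<close>.  Exchanging the roles of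
  \<open>a\<close> and \<open>t\<close> and adding gives \<open>2 L\<^bsub>a+t\<^esub> = 2 L\<^sub>a + 2 L\<^sub>t\<close>, and the factor \<open>2\<close> cancels.

  If \<open>A\<close> is finite, two partial products of a product of more than \<open>|A|\<close> factors coincide, so some partial
  product \<open>e\<close> satisfies \<open>e = e s\<close>; as \<open>- s\<close> is invertible for \<open>\<circ>\<close>, this forces \<open>e = 0\<close>.
\<close>

text \<open>The order of \<open>x\<close> divides the prime 2; with order 2 excluded it is
  1.\<close>

lemma (in abelian_group) double_eq_zero_imp:
  assumes "\<forall>a\<in>carrier G. group.ord (add_monoid G) a \<noteq> 2"
    and x: "x \<in> carrier G" and "x \<oplus> x = \<zero>"
  shows "x = \<zero>"
proof -
  have "x [^]\<^bsub>add_monoid G\<^esub> (2::nat) = \<one>\<^bsub>add_monoid G\<^esub>"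
    using assms by (simp add: numeral_2_eq_2)
  then have "add.ord x dvd 2" using group.pow_eq_id[OF a_group, of x 2] x by simp
  then have "add.ord x = 1 \<or> add.ord x = 2"
    using two_is_prime_nat prime_nat_iff by blast
  then show ?thesis using assms group.ord_eq_1[OF a_group, of x] by auto
qed

lemma (in abelian_group) double_cancel:
  assumes "\<forall>a\<in>carrier G. group.ord (add_monoid G) a \<noteq> 2"
    and "x \<in> carrier G" "y \<in> carrier G" "x \<oplus> x = y \<oplus> y"
  shows "x = y"
proof -
  have "(x \<ominus> y) \<oplus> (x \<ominus> y) = (x \<oplus> x) \<oplus> \<ominus> (y \<oplus> y)"
    using assms(2,3) by (simp add: minus_eq minus_add a_ac)
  also have "\<dots> = \<zero>" using assms by (simp add: r_neg)
  finally have "x \<ominus> y = \<zero>"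
    by (rule double_eq_zero_imp[OF assms(1), rotated]) (simp_all add: assms(2,3))
  then show ?thesis using assms(2,3) minus_equality[of x "\<ominus> y"] by (simp add: minus_eq)
qed

context left_brace
begin

lemma r_zero_mult: "a \<in> carrier A \<Longrightarrow> a \<otimes> \<zero> = \<zero>"
  using r_distr[of a \<zero> \<zero>] m_closed[of a \<zero>] by (simp add: add.r_cancel_one')

lemma r_minus_mult:
  assumes "a \<in> carrier A" "b \<in> carrier A"
  shows "a \<otimes> (\<ominus> b) = \<ominus> (a \<otimes> b)"
proof -
  have "a \<otimes> (\<ominus> b) \<oplus> a \<otimes> b = \<zero>"
    using assms r_distr[of a "\<ominus> b" b] by (simp add: l_neg r_zero_mult)
  then show ?thesis using assms m_closed by (intro minus_equality[symmetric]) auto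
qed

lemma circ_closed: "a \<in> carrier A \<Longrightarrow> b \<in> carrier A \<Longrightarrow> circ A a b \<in> carrier A"
  by (simp add: circ_def m_closed)

text \<open>Expand both sides of \<open>(a \<circ> b) \<circ> c = a \<circ> (b \<circ> c)\<close>
  using left-brace distributivity only, then cancel the common summands.\<close>

lemma circ_mult:
  assumes [simp]: "a \<in> carrier A" "b \<in> carrier A" "c \<in> carrier A"
  shows "circ A a b \<otimes> c = a \<otimes> (b \<otimes> c) \<oplus> a \<otimes> c \<oplus> b \<otimes> c"
proof -
  interpret C: group "circle_group A" by (rule circle_group)
  note [simp] = m_closed circ_closed
  have "circ A (circ A a b) c = circ A a (circ A b c)"
    using C.m_assoc[of a b c] by (simp add: circle_group_def)
  then have "(a \<otimes> b \<oplus> a \<oplus> b \<oplus> c) \<oplus> circ A a b \<otimes> c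
      = (a \<otimes> b \<oplus> a \<oplus> b \<oplus> c) \<oplus> (a \<otimes> (b \<otimes> c) \<oplus> a \<otimes> c \<oplus> b \<otimes> c)"
    by (simp add: circ_def r_distr a_ac)
  then show ?thesis by (subst (asm) add.l_cancel) auto
qed

lemma circ_surj:
  assumes "a \<in> carrier A" "d \<in> carrier A"
  obtains b where "b \<in> carrier A" "circ A a b = d"
proof -
  interpret C: group "circle_group A" by (rule circle_group)
  have a: "a \<in> carrier (circle_group A)" and d: "d \<in> carrier (circle_group A)"
    using assms by (auto simp: circle_group_def)
  have "a \<otimes>\<^bsub>circle_group A\<^esub> (inv\<^bsub>circle_group A\<^esub> a \<otimes>\<^bsub>circle_group A\<^esub> d) = d"
    using a d by (simp flip: C.m_assoc)
  with a d that[of "inv\<^bsub>circle_group A\<^esub> a \<otimes>\<^bsub>circle_group A\<^esub> d"] show ?thesis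
    using C.m_closed[OF C.inv_closed[OF a] d] by (simp add: circle_group_def)
qed

lemma two_sided_braceI:
  assumes ord: "\<forall>a\<in>carrier A. group.ord (add_monoid A) a \<noteq> 2"
    and neg: "\<And>a b. a \<in> carrier A \<Longrightarrow> b \<in> carrier A \<Longrightarrow> (\<ominus> a) \<otimes> b = \<ominus> (a \<otimes> b)"
  shows "two_sided_brace A"
proof unfold_locales
  note [simp] = m_closed
  have jensen: "(a \<oplus> t) \<otimes> c \<oplus> (a \<ominus> t) \<otimes> c = a \<otimes> c \<oplus> a \<otimes> c"
    if [simp]: "a \<in> carrier A" "t \<in> carrier A" "c \<in> carrier A" for a t c
  proof -
    obtain b where [simp]: "b \<in> carrier A" and b: "circ A a b = a \<oplus> t"
      using circ_surj[of a "a \<oplus> t"] by auto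
    have "a \<oplus> (a \<otimes> b \<oplus> b) = a \<oplus> t" using b by (simp add: circ_def a_ac)
    then have t: "t = a \<otimes> b \<oplus> b" by (subst (asm) add.l_cancel) auto
    \<comment> \<open>Replacing \<open>b\<close> by its negative flips the sign of the shift
      \<open>t = a \<otimes> b \<oplus> b\<close>, so both arguments in Jensen's equation are circle
      products with left factor \<open>a\<close>.\<close>
    have "a \<ominus> t = circ A a (\<ominus> b)"
      by (simp add: t circ_def minus_eq minus_add r_minus_mult a_ac)
    then have "(a \<oplus> t) \<otimes> c \<oplus> (a \<ominus> t) \<otimes> c
        = (a \<otimes> (b \<otimes> c) \<oplus> a \<otimes> c \<oplus> b \<otimes> c)
          \<oplus> (\<ominus> (a \<otimes> (b \<otimes> c)) \<oplus> a \<otimes> c \<oplus> \<ominus> (b \<otimes> c))"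
      by (simp add: b[symmetric] circ_mult neg r_minus_mult)
    also have "\<dots> = a \<otimes> c \<oplus> a \<otimes> c \<oplus> (a \<otimes> (b \<otimes> c) \<oplus> \<ominus> (a \<otimes> (b \<otimes> c)))
          \<oplus> (b \<otimes> c \<oplus> \<ominus> (b \<otimes> c))"
      by (simp add: a_ac)
    finally show ?thesis by (simp add: r_neg)
  qed
  fix a b c
  assume [simp]: "a \<in> carrier A" "b \<in> carrier A" "c \<in> carrier A"
  have "b \<ominus> a = \<ominus> (a \<ominus> b)" by (simp add: minus_eq minus_add a_ac)
  then have swap: "(b \<ominus> a) \<otimes> c = \<ominus> ((a \<ominus> b) \<otimes> c)" by (simp add: neg)
  \<comment> \<open>The inserted pair sums to zero; by \<open>swap\<close> its second term is
    \<open>(b \<ominus> a) \<otimes> c\<close>, so the sum regroups into two instances of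
    \<open>jensen\<close>.\<close>
  have "(a \<oplus> b) \<otimes> c \<oplus> (a \<oplus> b) \<otimes> c
      = ((a \<oplus> b) \<otimes> c \<oplus> (a \<oplus> b) \<otimes> c) \<oplus> ((a \<ominus> b) \<otimes> c \<oplus> \<ominus> ((a \<ominus> b) \<otimes> c))"
    by (simp add: r_neg)
  also have "\<dots> = ((a \<oplus> b) \<otimes> c \<oplus> (a \<ominus> b) \<otimes> c) \<oplus> ((b \<oplus> a) \<otimes> c \<oplus> (b \<ominus> a) \<otimes> c)"
    unfolding swap a_comm[OF \<open>b \<in> carrier A\<close> \<open>a \<in> carrier A\<close>]
    by (simp add: a_ac)
  also have "\<dots> = (a \<otimes> c \<oplus> b \<otimes> c) \<oplus> (a \<otimes> c \<oplus> b \<otimes> c)"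
    unfolding jensen[OF \<open>a \<in> carrier A\<close> \<open>b \<in> carrier A\<close> \<open>c \<in> carrier A\<close>]
      jensen[OF \<open>b \<in> carrier A\<close> \<open>a \<in> carrier A\<close> \<open>c \<in> carrier A\<close>]
    by (simp add: a_ac)
  finally show "(a \<oplus> b) \<otimes> c = a \<otimes> c \<oplus> b \<otimes> c"
    by (rule double_cancel[OF ord, rotated -1]) simp_all
qed

end

text \<open>Once \<open>circ A a b \<otimes> c\<close> can be expanded by distributivity on the
  other side, \<open>circ_mult\<close> becomes associativity plus the summands
  \<open>a \<otimes> c\<close> and \<open>b \<otimes> c\<close> on both sides.\<close>

lemma (in two_sided_brace) m_assoc:
  assumes [simp]: "a \<in> carrier A" "b \<in> carrier A" "c \<in> carrier A"
  shows "(a \<otimes> b) \<otimes> c = a \<otimes> (b \<otimes> c)"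
proof -
  note [simp] = m_closed
  have "(a \<otimes> c \<oplus> b \<otimes> c) \<oplus> (a \<otimes> b) \<otimes> c = (a \<otimes> c \<oplus> b \<otimes> c) \<oplus> a \<otimes> (b \<otimes> c)"
    using circ_mult[of a b c] by (simp add: circ_def l_distr a_ac)
  then show ?thesis by (subst (asm) add.l_cancel) auto
qed

sublocale two_sided_brace \<subseteq> jacobson_radical_ring
  by (intro jacobson_radical_ring.intro jacobson_radical_ring_axioms.intro nonunital_ring.intro
      nonunital_ring_axioms.intro abelian_group_axioms m_closed m_assoc l_distr r_distr
      circle_group)

context nonunital_ring
begin

lemma l_zero_mult: "a \<in> carrier A \<Longrightarrow> \<zero> \<otimes> a = \<zero>"
  using l_distr[of \<zero> \<zero> a] m_closed[of \<zero> a] by (simp add: add.r_cancel_one')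

lemma foldl_mult_closed:
  "a \<in> carrier A \<Longrightarrow> set as \<subseteq> carrier A \<Longrightarrow> foldl (\<otimes>) a as \<in> carrier A"
  by (induction as arbitrary: a) (auto simp: m_closed)

lemma foldl_zero_mult: "set as \<subseteq> carrier A \<Longrightarrow> foldl (\<otimes>) \<zero> as = \<zero>"
  by (induction as) (auto simp: l_zero_mult)

lemma foldl_mult_assoc:
  "a \<in> carrier A \<Longrightarrow> b \<in> carrier A \<Longrightarrow> set as \<subseteq> carrier A
    \<Longrightarrow> foldl (\<otimes>) (a \<otimes> b) as = a \<otimes> foldl (\<otimes>) b as"
  by (induction as arbitrary: b) (auto simp: m_closed m_assoc)

end

context jacobson_radical_ring
begin

sublocale left_brace
  by (intro left_brace.intro left_brace_axioms.intro abelian_group_axioms m_closed r_distr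
      circle_group)

text \<open>In unital terms, \<open>e\<close> is annihilated by the invertible element 1 - s.
  Without an identity, the circle inverse \<open>y\<close> of \<open>\<ominus> s\<close> plays the
  part of the inverse of 1 - s.\<close>

lemma mult_fixed_imp_zero:
  assumes [simp]: "e \<in> carrier A" "s \<in> carrier A" and es: "e \<otimes> s = e"
  shows "e = \<zero>"
proof -
  note [simp] = m_closed
  obtain y where [simp]: "y \<in> carrier A" and y: "circ A (\<ominus> s) y = \<zero>"
    using circ_surj[of "\<ominus> s" \<zero>] by auto
  have neg: "e \<otimes> (\<ominus> s) = \<ominus> e" by (simp add: r_minus_mult es)
  have "\<zero> = e \<otimes> circ A (\<ominus> s) y" by (simp add: y r_zero_mult)
  also have "\<dots> = e \<otimes> (\<ominus> s) \<otimes> y \<oplus> e \<otimes> (\<ominus> s) \<oplus> e \<otimes> y"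
    by (simp add: circ_def r_distr m_assoc)
  also have "\<dots> = ((\<ominus> e) \<otimes> y \<oplus> e \<otimes> y) \<oplus> \<ominus> e"
    unfolding neg by (simp add: a_ac)
  also have "(\<ominus> e) \<otimes> y \<oplus> e \<otimes> y = \<zero>"
    using l_distr[of "\<ominus> e" e y] by (simp add: l_neg l_zero_mult)
  finally have "\<ominus> e = \<zero>" by simp
  then show ?thesis using minus_minus[of e] by simp
qed

lemma finite_imp_nilpotent:
  assumes fin: "finite (carrier A)"
  shows "nilpotent_ring A"
proof unfold_locales
  let ?N = "card (carrier A)"
  have "foldl (\<otimes>) a as = \<zero>"
    if a: "a \<in> carrier A" and as: "set as \<subseteq> carrier A" and len: "length as = ?N" for a as
  proof -
    \<comment> \<open>Since \<open>a\<close> is counted separately, \<open>q k\<close> has k + 1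
      factors, and \<open>q 0, ..., q ?N\<close> are one more than the elements of the
      carrier.\<close>
    define q where "q k = foldl (\<otimes>) a (take k as)" for k
    have q: "q k \<in> carrier A" for k
      unfolding q_def using a as set_take_subset[of k as] by (intro foldl_mult_closed) auto
    have "\<not> inj_on q {..?N}"
      using card_inj_on_le[of q "{..?N}" "carrier A"] q fin by auto
    then obtain i j where ij: "i < j" "j \<le> ?N" "q i = q j"
      unfolding inj_on_def by (metis atMost_iff linorder_neqE_nat)
    have step: "q l = foldl (\<otimes>) (q k) (drop k (take l as))" if "k \<le> l" for k l
      using that append_take_drop_id[of k "take l as"] unfolding q_def
      by (metis foldl_append min.absorb1 take_take)
    \<comment> \<open>The factors gained between \<open>q i\<close> and \<open>q j\<close> form a
      nonempty list because i < j; their product is the \<open>s\<close> with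
      \<open>q i \<otimes> s = q i\<close>.\<close>
    obtain b bs where bs: "drop i (take j as) = b # bs"
      using ij len by (cases "drop i (take j as)") auto
    have "set (b # bs) \<subseteq> carrier A"
      using as set_drop_subset[of i "take j as"] set_take_subset[of j as] unfolding bs by blast
    then have "q i \<otimes> foldl (\<otimes>) b bs = q i" and "foldl (\<otimes>) b bs \<in> carrier A"
      using step[of i j] ij bs q foldl_mult_assoc[of "q i" b bs] foldl_mult_closed[of b bs] by auto
    then have "q i = \<zero>" using mult_fixed_imp_zero q by blast
    \<comment> \<open>The full product extends the vanishing \<open>q i\<close> by right factors,
      hence vanishes too.\<close>
    moreover have "foldl (\<otimes>) a as = foldl (\<otimes>) (q i) (drop i as)"
      using step[of i ?N] ij len by (simp add: q_def)
    ultimately show ?thesis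
      using foldl_zero_mult[of "drop i as"] as set_drop_subset[of i as] by auto
  qed
  then show "\<exists>n>0. \<forall>a as. a \<in> carrier A \<and> set as \<subseteq> carrier A \<and> length (a # as) = n
      \<longrightarrow> foldl (\<otimes>) a as = \<zero>"
    by (intro exI[of _ "Suc ?N"]) auto
qed

end

theorem theorem14:
  fixes A :: "('a, 'b) ring_scheme" (structure)
  assumes "left_brace A"
    and "\<forall>a\<in>carrier A. group.ord (add_monoid A) a \<noteq> 2"
    and "\<forall>a\<in>carrier A. \<forall>b\<in>carrier A. (\<ominus> a) \<otimes> b = \<ominus> (a \<otimes> b)"
  shows "two_sided_brace A \<and> jacobson_radical_ring A
    \<and> (finite (carrier A) \<longrightarrow> nilpotent_ring A)"
proof -
  interpret left_brace A by fact
  interpret two_sided_brace A using assms(2,3) by (intro two_sided_braceI) auto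
  show ?thesis
    using two_sided_brace_axioms jacobson_radical_ring_axioms finite_imp_nilpotent by blast
qed

end
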